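(* Fix $\alpha,\beta\in(0,\infty)$. Let $X_n=\sum_{j=1}^{n-1}\mathbf{1}\{S_{n,\alpha,\beta}(j)\neq 0\}$ be the number of symbols (non-empty boxes) on the second main diagonal of the random $\alpha/\beta$-staircase tableau $S_{n,\alpha,\beta}$. Then, as $n\to\infty$, $X_n$ converges in distribution to a Poisson random variable with parameter $1$.
   Context: A staircase tableau of size $n$ is a Young diagram of shape $(n,n-1,\dots,1)$ (row $i$ has boxes $(i,j)$, $1\le j\le n-i+1$; rows numbered top to bottom, columns left to right) whose boxes are empty or contain a symbol, such that: all boxes in the same column and above an $\alpha$ are empty; all boxes in the same row and to the left of a $\beta$ are empty; every box $(i,j)$ with $i+j=n+1$ (main diagonal) contains a symbol. An $\alpha/\beta$-staircase tableau uses only the symbols $\alpha,\beta$; its weight is $\alpha^{N_\alpha}\beta^{N_\beta}$ ($N_\alpha,N_\beta$ the numbers of $\alpha$'s and $\beta$'s). $S_{n,\alpha,\beta}$ is the random $\alpha/\beta$-staircase tableau of size $n$ with $\mathbb{P}(S_{n,\alpha,\beta}=S)=wt(S)/\sum_{S'}wt(S')$. The second main diagonal consists of the boxes $(n-i,i)$, $i=1,\dots,n-1$, and $S_{n,\alpha,\beta}(i)$ denotes the content of box $(n-i,i)$. *)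

theory Defs
  imports "HOL-Probability.Probability"
begin

datatype symbol = Alpha | Beta

definition staircase_boxes :: "nat \<Rightarrow> (nat \<times> nat) set" where
  "staircase_boxes n = {(i, j). 1 \<le> i \<and> 1 \<le> j \<and> i + j \<le> n + 1}"

(* A filling is a partial map from boxes (row, column), both counted from 1, to symbols;
   None is an empty box. Requiring the domain to lie in the shape makes the encoding of a
   tableau of size n unique. *)
definition ab_staircase_tableaux :: "nat \<Rightarrow> (nat \<times> nat \<rightharpoonup> symbol) set" where
  "ab_staircase_tableaux n = {T. dom T \<subseteq> staircase_boxes n
     \<and> (\<forall>i j. T (i, j) = Some Alpha \<longrightarrow> (\<forall>i' < i. T (i', j) = None))
     \<and> (\<forall>i j. T (i, j) = Some Beta \<longrightarrow> (\<forall>j' < j. T (i, j') = None))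
     \<and> (\<forall>(i, j) \<in> staircase_boxes n. i + j = n + 1 \<longrightarrow> T (i, j) \<noteq> None)}"

definition tableau_weight :: "real \<Rightarrow> real \<Rightarrow> (nat \<times> nat \<rightharpoonup> symbol) \<Rightarrow> real" where
  "tableau_weight \<alpha> \<beta> T = \<alpha> ^ card {b. T b = Some Alpha} * \<beta> ^ card {b. T b = Some Beta}"

(* embed_pmf is only meaningful for nonnegative functions of total mass 1; the lemma
   pmf_random_tableau below establishes this for positive parameters. *)
definition random_tableau :: "nat \<Rightarrow> real \<Rightarrow> real \<Rightarrow> (nat \<times> nat \<rightharpoonup> symbol) pmf" where
  "random_tableau n \<alpha> \<beta> = embed_pmf (\<lambda>T.
     if T \<in> ab_staircase_tableaux n
     then tableau_weight \<alpha> \<beta> T / (\<Sum>T' \<in> ab_staircase_tableaux n. tableau_weight \<alpha> \<beta> T')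
     else 0)"

definition second_diagonal_symbols :: "nat \<Rightarrow> (nat \<times> nat \<rightharpoonup> symbol) \<Rightarrow> nat" where
  "second_diagonal_symbols n T = (\<Sum>j = 1..n - 1. of_bool (T (n - j, j) \<noteq> None))"

lemma finite_staircase_boxes: "finite (staircase_boxes n)"
  by (rule finite_subset[of _ "{..n + 1} \<times> {..n + 1}"]) (auto simp: staircase_boxes_def)

lemma finite_ab_staircase_tableaux: "finite (ab_staircase_tableaux n)"
proof -
  have "(UNIV :: symbol set) = {Alpha, Beta}"
    using symbol.exhaust by auto
  then have "finite (UNIV :: symbol set)"
    by (metis finite.emptyI finite.insertI)
  then have "finite (\<Union>D \<in> Pow (staircase_boxes n). {T. dom T = D \<and> ran T \<subseteq> (UNIV :: symbol set)})"
    using finite_staircase_boxes[of n]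
    by (intro finite_UN_I finite_set_of_finite_maps) (auto intro: finite_subset)
  then show ?thesis
    by (rule rev_finite_subset) (auto simp: ab_staircase_tableaux_def)
qed

lemma ab_staircase_tableaux_nonempty: "ab_staircase_tableaux n \<noteq> {}"
proof -
  have "(\<lambda>(i, j). if (i, j) \<in> staircase_boxes n \<and> i + j = n + 1 then Some Alpha else None)
      \<in> ab_staircase_tableaux n"
    by (auto simp: ab_staircase_tableaux_def split: if_splits)
  then show ?thesis by blast
qed

lemma pmf_random_tableau:
  assumes "\<alpha> > 0" "\<beta> > 0"
  shows "pmf (random_tableau n \<alpha> \<beta>) T =
    (if T \<in> ab_staircase_tableaux n
     then tableau_weight \<alpha> \<beta> T / (\<Sum>T' \<in> ab_staircase_tableaux n. tableau_weight \<alpha> \<beta> T')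
     else 0)"
proof -
  let ?A = "ab_staircase_tableaux n" and ?w = "tableau_weight \<alpha> \<beta>"
  let ?f = "\<lambda>T. if T \<in> ?A then ?w T / sum ?w ?A else 0"
  have w: "?w T > 0" for T
    using assms by (simp add: tableau_weight_def)
  have Z: "sum ?w ?A > 0"
    by (intro sum_pos finite_ab_staircase_tableaux ab_staircase_tableaux_nonempty w)
  have nonneg: "?f T \<ge> 0" for T
    using w[of T] Z by simp
  have "(\<integral>\<^sup>+T. ennreal (?f T) \<partial>count_space UNIV) = (\<Sum>T\<in>?A. ennreal (?f T))"
    by (intro nn_integral_count_space' finite_ab_staircase_tableaux) auto
  also have "\<dots> = ennreal (\<Sum>T\<in>?A. ?f T)"
    by (intro sum_ennreal nonneg)
  also have "(\<Sum>T\<in>?A. ?f T) = 1"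
    using Z by (simp flip: sum_divide_distrib)
  finally show ?thesis
    unfolding random_tableau_def by (subst pmf_embed_pmf[OF nonneg]) auto
qed

end

(* Deleting the first column of a tableau shows that the sum D n x of wt(T) x^(number of rows
   without beta) satisfies D (n+1) x = (alpha x + beta) D n (x + beta); at x = 1 this gives the
   partition function Z n = (alpha + beta) (alpha + beta + alpha beta) ... with n factors.

   A symbol in a box of the second diagonal forces beta below it and alpha to its right, and then
   the row of that beta and the column of that alpha are otherwise empty. Deleting them maps the
   tableaux of size n + 1 with this box filled bijectively onto all tableaux of size n, dividing
   the weight by alpha beta. So adjacent boxes are never both filled, and r given pairwise
   non-adjacent boxes are all filled with probability (alpha beta)^r Z (n-r) / Z n. Hence
   E (X_n choose r) = (n-r choose r) (alpha beta)^r Z (n-r) / Z n, which is at most 1/r! and tends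
   to 1/r!. The characteristic function of X_n is the sum of (e^(it) - 1)^r E (X_n choose r), which
   by dominated convergence tends to exp (e^(it) - 1), and Levy's continuity theorem applies. *)

theory Submission
  imports Defs "HOL-Real_Asymp.Real_Asymp"
begin

section \<open>The partition function\<close>

fun symbol_weight :: "real \<Rightarrow> real \<Rightarrow> symbol option \<Rightarrow> real" where
  "symbol_weight \<alpha> \<beta> None = 1"
| "symbol_weight \<alpha> \<beta> (Some Alpha) = \<alpha>"
| "symbol_weight \<alpha> \<beta> (Some Beta) = \<beta>"

text \<open>Empty boxes weigh 1, so \<open>D\<close> may be any finite superset of the domain. In
  product form the weight factors whenever the boxes are split into groups.\<close>

lemma tableau_weight_eq_prod:
  assumes "finite D" "dom T \<subseteq> D"
  shows "tableau_weight \<alpha> \<beta> T = (\<Prod>b\<in>D. symbol_weight \<alpha> \<beta> (T b))"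
proof -
  have *: "symbol_weight \<alpha> \<beta> s =
    (if s = Some Alpha then \<alpha> else 1) * (if s = Some Beta then \<beta> else 1)" for s
    by (cases "(\<alpha>, \<beta>, s)" rule: symbol_weight.cases) auto
  have "D \<inter> {b. T b = Some s} = {b. T b = Some s}" for s
    using assms(2) by auto
  then show ?thesis
    using assms(1) by (simp add: * prod.distrib prod.If_cases tableau_weight_def)
qed

text \<open>Possible contents of a new first column, with \<open>F\<close> the rows allowed to
  receive a symbol. The \<beta>-condition is encoded in \<open>F\<close>: a row with a \<beta>
  further right must stay empty, and a \<beta> in the first column has nothing to its left.\<close>

definition alpha_columns :: "nat set \<Rightarrow> (nat \<rightharpoonup> symbol) set" where
  "alpha_columns F = {c. dom c \<subseteq> F \<and> (\<forall>i. c i = Some Alpha \<longrightarrow> (\<forall>i'<i. c i' = None))}"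

text \<open>In a row with no \<open>\<beta>\<close> further right, an entry of the new first column contributes its own
  weight, and \<open>x\<close> if the row stays free of \<open>\<beta>\<close>.\<close>

fun row_weight :: "real \<Rightarrow> real \<Rightarrow> real \<Rightarrow> symbol option \<Rightarrow> real" where
  "row_weight \<alpha> \<beta> x None = x"
| "row_weight \<alpha> \<beta> x (Some Alpha) = \<alpha> * x"
| "row_weight \<alpha> \<beta> x (Some Beta) = \<beta>"

lemma finite_alpha_columns:
  assumes "finite F"
  shows "finite (alpha_columns F)"
proof -
  have "(UNIV :: symbol set) = {Alpha, Beta}"
    using symbol.exhaust by auto
  then have "finite (UNIV :: symbol set)"
    by (metis finite.emptyI finite.insertI)
  then have "finite (\<Union>D \<in> Pow F. {c. dom c = D \<and> ran c \<subseteq> (UNIV :: symbol set)})"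
    using assms by (intro finite_UN_I finite_set_of_finite_maps) (auto intro: finite_subset)
  then show ?thesis
  proof (rule rev_finite_subset, intro subsetI)
    fix c assume "c \<in> alpha_columns F"
    then show "c \<in> (\<Union>D \<in> Pow F. {c. dom c = D \<and> ran c \<subseteq> (UNIV :: symbol set)})"
      unfolding alpha_columns_def by blast
  qed
qed

text \<open>An \<alpha> in the lowest row \<open>m\<close> empties the whole column above it, which
  leaves one column; a \<beta> or an empty box in row \<open>m\<close> puts no condition on the rows
  above.\<close>

lemma columns_insert_max:
  assumes "\<forall>a\<in>F. a < m"
  shows "{c \<in> alpha_columns (insert m F). c m = None} = alpha_columns F"
    and "{c \<in> alpha_columns (insert m F). c m \<noteq> None} =
      insert [m \<mapsto> Alpha] ((\<lambda>c. c(m \<mapsto> Beta)) ` alpha_columns F)"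
proof -
  show "{c \<in> alpha_columns (insert m F). c m = None} = alpha_columns F"
    using assms by (auto simp: alpha_columns_def dom_def)
  show "{c \<in> alpha_columns (insert m F). c m \<noteq> None} =
      insert [m \<mapsto> Alpha] ((\<lambda>c. c(m \<mapsto> Beta)) ` alpha_columns F)" (is "?L = ?R")
  proof (intro equalityI subsetI)
    fix c assume c: "c \<in> ?L"
    show "c \<in> ?R"
    proof (cases "c m = Some Alpha")
      case True
      have "c i = None" if "i \<noteq> m" for i
      proof (rule ccontr)
        assume "c i \<noteq> None"
        then have "i \<in> F" using c that by (auto simp: alpha_columns_def)
        then have "i < m" using assms by blast
        then show False using c True \<open>c i \<noteq> None\<close> by (auto simp: alpha_columns_def)
      qed
      then have "c = [m \<mapsto> Alpha]" using True by auto
      then show ?thesis by simp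
    next
      case False
      then have *: "c m = Some Beta" using c by (cases "c m") (auto intro: symbol.exhaust)
      have "c(m := None) \<in> alpha_columns F"
        using c by (auto simp: alpha_columns_def dom_def split: if_splits)
      moreover have "c = (c(m := None))(m \<mapsto> Beta)" using * by auto
      ultimately show ?thesis by blast
    qed
  next
    fix c assume "c \<in> ?R"
    then consider "c = [m \<mapsto> Alpha]" | d where "d \<in> alpha_columns F" "c = d(m \<mapsto> Beta)" by auto
    then show "c \<in> ?L"
    proof cases
      case 1
      then show ?thesis by (auto simp: alpha_columns_def)
    next
      case (2 d)
      have "\<not> m < i" if "d i = Some Alpha" for i
        using that 2(1) assms by (auto simp: alpha_columns_def dom_def dest!: subsetD)
      then show ?thesis using 2 by (auto simp: alpha_columns_def dom_def)
    qed
  qed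
qed

text \<open>The lowest box of a new column lies on the main diagonal, so only columns filled there
  matter. An \<alpha> there leaves the rows of \<open>F\<close> empty, each contributing
  \<open>x\<close>; a \<beta> leaves the rest of the column free.\<close>

lemma sum_columns_nonempty_max:
  assumes "finite F" "\<forall>a\<in>F. a < m"
  shows "(\<Sum>c | c \<in> alpha_columns (insert m F) \<and> c m \<noteq> None. \<Prod>i\<in>insert m F. row_weight \<alpha> \<beta> x (c i)) =
    \<beta> * (\<Sum>c\<in>alpha_columns F. \<Prod>i\<in>F. row_weight \<alpha> \<beta> x (c i)) + \<alpha> * x ^ Suc (card F)"
proof -
  let ?G = "\<lambda>c. \<Prod>i\<in>insert m F. row_weight \<alpha> \<beta> x (c i)"
  have m: "m \<notin> F" using assms by auto
  have inj: "inj_on (\<lambda>c. c(m \<mapsto> Beta)) (alpha_columns F)"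
  proof (rule inj_onI)
    fix c d assume cd: "c \<in> alpha_columns F" "d \<in> alpha_columns F" "c(m \<mapsto> Beta) = d(m \<mapsto> Beta)"
    have "c m = None" "d m = None" using cd(1,2) m by (auto simp: alpha_columns_def dom_def)
    then have "c = (c(m \<mapsto> Beta))(m := None)" "d = (d(m \<mapsto> Beta))(m := None)" by auto
    then show "c = d" using cd(3) by metis
  qed
  have neq: "[m \<mapsto> Alpha] \<notin> (\<lambda>c. c(m \<mapsto> Beta)) ` alpha_columns F"
    by (auto simp: fun_eq_iff split: if_splits)
  have upd: "?G (c(m \<mapsto> s)) =
      row_weight \<alpha> \<beta> x (Some s) * (\<Prod>i\<in>F. row_weight \<alpha> \<beta> x (c i))" for c s
    using assms(1) m by (auto intro!: arg_cong2[of _ _ _ _ "(*)"] prod.cong)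
  have "(\<Sum>c | c \<in> alpha_columns (insert m F) \<and> c m \<noteq> None. ?G c) =
      ?G [m \<mapsto> Alpha] + (\<Sum>c\<in>(\<lambda>c. c(m \<mapsto> Beta)) ` alpha_columns F. ?G c)"
    unfolding columns_insert_max(2)[OF assms(2)]
    by (intro sum.insert neq finite_imageI finite_alpha_columns assms(1))
  also have "?G [m \<mapsto> Alpha] = \<alpha> * x ^ Suc (card F)"
    unfolding upd by simp
  also have "(\<Sum>c\<in>(\<lambda>c. c(m \<mapsto> Beta)) ` alpha_columns F. ?G c) =
      \<beta> * (\<Sum>c\<in>alpha_columns F. \<Prod>i\<in>F. row_weight \<alpha> \<beta> x (c i))"
    unfolding sum.reindex[OF inj] o_def upd by (simp add: sum_distrib_left)
  finally show ?thesis by simp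
qed

text \<open>The sum over the columns is multiplied by \<open>\<beta>\<close> to avoid dividing by it: it is the geometric
  sum over the position of the topmost \<open>\<alpha>\<close>.\<close>

lemma sum_columns:
  assumes "finite F"
  shows "\<beta> * (\<Sum>c\<in>alpha_columns F. \<Prod>i\<in>F. row_weight \<alpha> \<beta> x (c i)) =
    (\<alpha> * x + \<beta>) * (x + \<beta>) ^ card F - \<alpha> * x ^ Suc (card F)"
  using assms
proof (induction rule: finite_linorder_max_induct)
  case empty
  have "alpha_columns {} = {Map.empty}" by (auto simp: alpha_columns_def)
  then show ?case by simp
next
  case (insert m F)
  let ?G = "\<lambda>c. \<Prod>i\<in>insert m F. row_weight \<alpha> \<beta> x (c i)"
  have m: "m \<notin> F" using insert by auto
  \<comment> \<open>The columns are split by whether row \<open>m\<close> is empty; if it is, it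
    contributes a factor \<open>x\<close>.\<close>
  have "(\<Sum>c\<in>alpha_columns F. ?G c) = (\<Sum>c\<in>alpha_columns F. x * (\<Prod>i\<in>F. row_weight \<alpha> \<beta> x (c i)))"
  proof (rule sum.cong)
    fix c assume "c \<in> alpha_columns F"
    then have "c m = None" using m by (auto simp: alpha_columns_def dom_def)
    then show "?G c = x * (\<Prod>i\<in>F. row_weight \<alpha> \<beta> x (c i))"
      using m insert.hyps by simp
  qed simp
  moreover have "(\<Sum>c\<in>alpha_columns (insert m F). ?G c) =
      (\<Sum>c | c \<in> alpha_columns (insert m F) \<and> c m = None. ?G c) +
      (\<Sum>c | c \<in> alpha_columns (insert m F) \<and> c m \<noteq> None. ?G c)"
    using insert.hyps(1)
    by (subst sum.union_disjoint[symmetric])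
      (auto intro!: sum.cong finite_subset[OF _ finite_alpha_columns[of "insert m F"]])
  ultimately have "(\<Sum>c\<in>alpha_columns (insert m F). ?G c) =
      (x + \<beta>) * (\<Sum>c\<in>alpha_columns F. \<Prod>i\<in>F. row_weight \<alpha> \<beta> x (c i)) + \<alpha> * x ^ Suc (card F)"
    by (simp only: columns_insert_max(1)[OF insert.hyps(2)]
        sum_columns_nonempty_max[OF insert.hyps(1,2)] sum_distrib_left[symmetric] ring_distribs)
  then have "\<beta> * (\<Sum>c\<in>alpha_columns (insert m F). ?G c) =
      (x + \<beta>) * (\<beta> * (\<Sum>c\<in>alpha_columns F. \<Prod>i\<in>F. row_weight \<alpha> \<beta> x (c i))) + \<alpha> * \<beta> * x ^ Suc (card F)"
    by (simp add: algebra_simps)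
  then show ?case
    using m insert.hyps(1) by (simp add: insert.IH algebra_simps)
qed

section \<open>Attaching a first column to a tableau\<close>

definition beta_free_rows :: "nat \<Rightarrow> (nat \<times> nat \<rightharpoonup> symbol) \<Rightarrow> nat set" where
  "beta_free_rows n T = {i \<in> {1..n}. \<forall>j. T (i, j) \<noteq> Some Beta}"

text \<open>Row \<open>m\<close> stands for the row in which the new column meets the main diagonal,
  where a symbol is compulsory.\<close>

definition bottom_columns :: "nat \<Rightarrow> nat set \<Rightarrow> (nat \<rightharpoonup> symbol) set" where
  "bottom_columns m F = {c. c \<in> alpha_columns (insert m F) \<and> c m \<noteq> None}"

text \<open>At \<open>j = 0\<close> truncated subtraction makes this read \<open>T (i, 0)\<close>,
  which is empty for every tableau, so no case for column 0 is needed.\<close>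

definition add_column :: "(nat \<times> nat \<rightharpoonup> symbol) \<Rightarrow> (nat \<rightharpoonup> symbol) \<Rightarrow> (nat \<times> nat \<rightharpoonup> symbol)" where
  "add_column T c = (\<lambda>(i, j). if j = 1 then c i else T (i, j - 1))"

lemma ab_staircase_tableauxD:
  assumes "T \<in> ab_staircase_tableaux n"
  shows "T (i, j) \<noteq> None \<Longrightarrow> 1 \<le> i \<and> 1 \<le> j \<and> i + j \<le> n + 1"
    and "T (i, j) = Some Alpha \<Longrightarrow> i' < i \<Longrightarrow> T (i', j) = None"
    and "T (i, j) = Some Beta \<Longrightarrow> j' < j \<Longrightarrow> T (i, j') = None"
    and "1 \<le> i \<Longrightarrow> 1 \<le> j \<Longrightarrow> i + j = n + 1 \<Longrightarrow> T (i, j) \<noteq> None"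
proof -
  note * = assms[unfolded ab_staircase_tableaux_def staircase_boxes_def mem_Collect_eq]
  show "1 \<le> i \<and> 1 \<le> j \<and> i + j \<le> n + 1" if "T (i, j) \<noteq> None"
  proof -
    have "(i, j) \<in> dom T" using that by blast
    then show ?thesis using * by blast
  qed
  show "T (i', j) = None" if "T (i, j) = Some Alpha" "i' < i"
    using * that by blast
  show "T (i, j') = None" if "T (i, j) = Some Beta" "j' < j"
    using * that by blast
  show "T (i, j) \<noteq> None" if "1 \<le> i" "1 \<le> j" "i + j = n + 1"
    using conjunct2[OF conjunct2[OF conjunct2[OF *]]] that by fastforce
qed

lemma ab_staircase_tableauxI:
  assumes "\<And>i j. T (i, j) \<noteq> None \<Longrightarrow> 1 \<le> i \<and> 1 \<le> j \<and> i + j \<le> n + 1"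
    and "\<And>i j i'. T (i, j) = Some Alpha \<Longrightarrow> i' < i \<Longrightarrow> T (i', j) = None"
    and "\<And>i j j'. T (i, j) = Some Beta \<Longrightarrow> j' < j \<Longrightarrow> T (i, j') = None"
    and "\<And>i j. 1 \<le> i \<Longrightarrow> 1 \<le> j \<Longrightarrow> i + j = n + 1 \<Longrightarrow> T (i, j) \<noteq> None"
  shows "T \<in> ab_staircase_tableaux n"
proof -
  have "dom T \<subseteq> {(i, j). 1 \<le> i \<and> 1 \<le> j \<and> i + j \<le> n + 1}"
    using assms(1) by blast
  moreover have "\<forall>(i, j) \<in> {(i, j). 1 \<le> i \<and> 1 \<le> j \<and> i + j \<le> n + 1}.
      i + j = n + 1 \<longrightarrow> T (i, j) \<noteq> None"
    using assms(4) by blast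
  ultimately show ?thesis
    unfolding ab_staircase_tableaux_def staircase_boxes_def using assms(2,3) by blast
qed

lemma tableau_column_0: "T \<in> ab_staircase_tableaux n \<Longrightarrow> T (i, 0) = None"
  using ab_staircase_tableauxD(1)[of T n i 0] by (cases "T (i, 0)") auto

lemma tableau_below: "T \<in> ab_staircase_tableaux n \<Longrightarrow> n < i \<Longrightarrow> T (i, j) = None"
  using ab_staircase_tableauxD(1)[of T n i j] by (cases "T (i, j)") auto

lemma add_column_in_tableaux:
  assumes "T \<in> ab_staircase_tableaux n" "c \<in> bottom_columns (Suc n) (beta_free_rows n T)"
  shows "add_column T c \<in> ab_staircase_tableaux (Suc n)"
proof -
  note T = ab_staircase_tableauxD[OF assms(1)]
  have c: "c i \<noteq> None \<Longrightarrow> i = Suc n \<or> i \<in> beta_free_rows n T"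
    "c i = Some Alpha \<Longrightarrow> i' < i \<Longrightarrow> c i' = None" "c (Suc n) \<noteq> None" for i i'
    using assms(2) by (auto simp: bottom_columns_def alpha_columns_def dom_def)
  show ?thesis
  proof (rule ab_staircase_tableauxI)
    fix i j assume "add_column T c (i, j) \<noteq> None"
    then show "1 \<le> i \<and> 1 \<le> j \<and> i + j \<le> Suc n + 1"
      using T(1)[of i "j - 1"] c(1)[of i]
      by (cases "j = 1") (auto simp: add_column_def beta_free_rows_def)
  next
    fix i j i' assume "add_column T c (i, j) = Some Alpha" "i' < i"
    then show "add_column T c (i', j) = None"
      using T(2)[of i "j - 1" i'] c(2)[of i i']
      by (cases "j = 1") (auto simp: add_column_def)
  next
    fix i j j' assume *: "add_column T c (i, j) = Some Beta" "j' < j"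
    have T0: "T (i, 0) = None" using assms(1) by (rule tableau_column_0)
    show "add_column T c (i, j') = None"
    proof (cases "j = 1")
      case True
      then show ?thesis using T0 * by (auto simp: add_column_def)
    next
      case False
      then have Tij: "T (i, j - 1) = Some Beta" using * by (auto simp: add_column_def)
      then have "i \<le> n" using T(1)[of i "j - 1"] by auto
      \<comment> \<open>Row \<open>i\<close> contains a \<beta> and is not the new bottom row, so it
        is not among the rows in which \<open>c\<close> may have a symbol.\<close>
      with Tij have "c i = None"
        using c(1)[of i] by (cases "c i") (auto simp: beta_free_rows_def)
      moreover have "T (i, j' - 1) = None" if "j' \<noteq> 1"
        using T(3)[OF Tij, of "j' - 1"] T0 that * by (cases "j' = 0") auto
      ultimately show ?thesis by (auto simp: add_column_def)
    qed
  next
    fix i j :: nat assume "1 \<le> i" "1 \<le> j" "i + j = Suc n + 1"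
    then show "add_column T c (i, j) \<noteq> None"
      using T(4)[of i "j - 1"] c(3) by (cases "j = 1") (auto simp: add_column_def)
  qed
qed

text \<open>Deleting the first column of a staircase of size n + 1 leaves one of size n, and the
  remaining tableau constrains the deleted column only through its rows without \<beta>.\<close>

lemma bij_betw_add_column:
  "bij_betw (\<lambda>(T, c). add_column T c)
    (SIGMA T:ab_staircase_tableaux n. bottom_columns (Suc n) (beta_free_rows n T))
    (ab_staircase_tableaux (Suc n))"
\<comment> \<open>The inverse shifts all columns left; column 0 is emptied explicitly because the
  old column 1 would otherwise land there.\<close>
proof (rule bij_betw_byWitness[where
      f' = "\<lambda>T. (\<lambda>(i, j). if j = 0 then None else T (i, j + 1), \<lambda>i. T (i, 1))"])
  show "\<forall>p\<in>SIGMA T:ab_staircase_tableaux n. bottom_columns (Suc n) (beta_free_rows n T).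
      (\<lambda>T. (\<lambda>(i, j). if j = 0 then None else T (i, j + 1), \<lambda>i. T (i, 1)))
        ((\<lambda>(T, c). add_column T c) p) = p"
    by (auto simp: add_column_def fun_eq_iff tableau_column_0)
  show "\<forall>T\<in>ab_staircase_tableaux (Suc n).
      (\<lambda>(T, c). add_column T c) (\<lambda>(i, j). if j = 0 then None else T (i, j + 1), \<lambda>i. T (i, 1)) = T"
  proof
    fix T assume "T \<in> ab_staircase_tableaux (Suc n)"
    then have "T (i, 0) = None" for i by (rule tableau_column_0)
    then show "(\<lambda>(T, c). add_column T c)
        (\<lambda>(i, j). if j = 0 then None else T (i, j + 1), \<lambda>i. T (i, 1)) = T"
      by (auto simp: add_column_def fun_eq_iff le_Suc_eq)
  qed
  show "(\<lambda>(T, c). add_column T c) `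
      (SIGMA T:ab_staircase_tableaux n. bottom_columns (Suc n) (beta_free_rows n T))
      \<subseteq> ab_staircase_tableaux (Suc n)"
    using add_column_in_tableaux by auto
  show "(\<lambda>T. (\<lambda>(i, j). if j = 0 then None else T (i, j + 1), \<lambda>i. T (i, 1))) `
      ab_staircase_tableaux (Suc n)
      \<subseteq> (SIGMA T:ab_staircase_tableaux n. bottom_columns (Suc n) (beta_free_rows n T))"
  proof (intro image_subsetI SigmaI)
    fix T assume "T \<in> ab_staircase_tableaux (Suc n)"
    note T = ab_staircase_tableauxD[OF this]
    let ?S = "\<lambda>(i, j). if j = 0 then None else T (i, j + 1)"
    show "?S \<in> ab_staircase_tableaux n"
    proof (rule ab_staircase_tableauxI)
      fix i j assume "?S (i, j) \<noteq> None"
      then show "1 \<le> i \<and> 1 \<le> j \<and> i + j \<le> n + 1"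
        using T(1)[of i "j + 1"] by (auto split: if_splits)
    next
      fix i j i' assume "?S (i, j) = Some Alpha" "i' < i"
      then show "?S (i', j) = None"
        using T(2)[of i "j + 1" i'] by (auto split: if_splits)
    next
      fix i j j' assume "?S (i, j) = Some Beta" "j' < j"
      then show "?S (i, j') = None"
        using T(3)[of i "j + 1" "j' + 1"] by (auto split: if_splits)
    next
      fix i j :: nat assume "1 \<le> i" "1 \<le> j" "i + j = n + 1"
      then show "?S (i, j) \<noteq> None"
        using T(4)[of i "j + 1"] by auto
    qed
    \<comment> \<open>A symbol in the first column excludes a \<beta> further right in its row, as
      that \<beta> would empty the box.\<close>
    have "i = Suc n \<or> i \<in> beta_free_rows n ?S" if "T (i, 1) \<noteq> None" for i
    proof -
      have "T (i, Suc j) \<noteq> Some Beta" if "j \<noteq> 0" for j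
        using T(3)[of i "Suc j" 1] \<open>T (i, 1) \<noteq> None\<close> that by auto
      then show ?thesis
        using T(1)[OF that] by (auto simp: beta_free_rows_def)
    qed
    then have "dom (\<lambda>i. T (i, 1)) \<subseteq> insert (Suc n) (beta_free_rows n ?S)"
      by blast
    moreover have "T (Suc n, 1) \<noteq> None"
      by (rule T(4)) auto
    ultimately show "(\<lambda>i. T (i, 1)) \<in> bottom_columns (Suc n) (beta_free_rows n ?S)"
      using T(2)[of _ 1] unfolding bottom_columns_def alpha_columns_def by blast
  qed
qed

lemma finite_dom_tableau:
  assumes "T \<in> ab_staircase_tableaux n"
  shows "finite (dom T)"
  using assms finite_staircase_boxes[of n]
  by (auto simp: ab_staircase_tableaux_def intro: finite_subset)

lemma finite_beta_free_rows: "finite (beta_free_rows n T)"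
  by (simp add: beta_free_rows_def)

text \<open>A row is free of \<beta> after the extension iff it was so before and \<open>c\<close>
  puts no \<beta> there; the new bottom row counts as free before. Each such row thus carries its
  symbol's weight and possibly \<open>x\<close>, as in \<open>row_weight\<close>.\<close>

lemma weight_add_column:
  assumes T: "T \<in> ab_staircase_tableaux n"
    and c: "c \<in> bottom_columns (Suc n) (beta_free_rows n T)"
  shows "tableau_weight \<alpha> \<beta> (add_column T c) * x ^ card (beta_free_rows (Suc n) (add_column T c)) =
    tableau_weight \<alpha> \<beta> T *
      (\<Prod>i\<in>insert (Suc n) (beta_free_rows n T). row_weight \<alpha> \<beta> x (c i))"
proof -
  let ?F = "insert (Suc n) (beta_free_rows n T)"
  have finF: "finite ?F" by (simp add: finite_beta_free_rows)
  have domc: "dom c \<subseteq> ?F" using c by (auto simp: bottom_columns_def alpha_columns_def)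
  \<comment> \<open>The boxes of the new tableau: the old ones moved one column to the right, and
    the first column.\<close>
  let ?D = "(\<lambda>(i, j). (i, Suc j)) ` dom T" and ?E = "(\<lambda>i. (i, 1)) ` ?F"
  have T0: "T (i, 0) = None" "T (Suc n, i) = None" for i
    using tableau_column_0[OF T] tableau_below[OF T] by auto
  have "dom (add_column T c) \<subseteq> ?D \<union> ?E"
  proof
    fix b assume b: "b \<in> dom (add_column T c)"
    obtain i j where ij: "b = (i, j)" by (cases b)
    show "b \<in> ?D \<union> ?E"
    proof (cases "j = 1")
      case True
      then have "i \<in> dom c" using b by (auto simp: ij add_column_def)
      then have "i \<in> ?F" using domc by blast
      then show ?thesis using True unfolding ij by blast
    next
      case False
      then have "(i, j - 1) \<in> dom T" using b by (auto simp: ij add_column_def)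
      moreover have "j \<noteq> 0"
        using T0 b by (cases "j = 0") (auto simp: ij add_column_def)
      then have "b = (\<lambda>(i, j). (i, Suc j)) (i, j - 1)" by (simp add: ij)
      ultimately show ?thesis by blast
    qed
  qed
  then have "tableau_weight \<alpha> \<beta> (add_column T c) =
      (\<Prod>b\<in>?D \<union> ?E. symbol_weight \<alpha> \<beta> (add_column T c b))"
    by (rule tableau_weight_eq_prod[rotated]) (use finF finite_dom_tableau[OF T] in auto)
  also have "\<dots> = (\<Prod>b\<in>?D. symbol_weight \<alpha> \<beta> (add_column T c b)) *
      (\<Prod>b\<in>?E. symbol_weight \<alpha> \<beta> (add_column T c b))"
    using finF finite_dom_tableau[OF T] T0(1) by (intro prod.union_disjoint) auto
  also have "(\<Prod>b\<in>?E. symbol_weight \<alpha> \<beta> (add_column T c b)) = (\<Prod>i\<in>?F. symbol_weight \<alpha> \<beta> (c i))"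
    by (subst prod.reindex) (auto simp: inj_on_def add_column_def)
  also have "(\<Prod>b\<in>?D. symbol_weight \<alpha> \<beta> (add_column T c b)) =
      (\<Prod>b\<in>dom T. symbol_weight \<alpha> \<beta> (T b))"
    using T0(1) by (subst prod.reindex) (auto simp: inj_on_def add_column_def intro!: prod.cong)
  also have "\<dots> = tableau_weight \<alpha> \<beta> T"
    by (rule tableau_weight_eq_prod[symmetric]) (use finite_dom_tableau[OF T] in auto)
  finally have w: "tableau_weight \<alpha> \<beta> (add_column T c) =
      tableau_weight \<alpha> \<beta> T * (\<Prod>i\<in>?F. symbol_weight \<alpha> \<beta> (c i))" .
  have "beta_free_rows (Suc n) (add_column T c) = ?F \<inter> {i. c i \<noteq> Some Beta}"
  proof (intro set_eqI)
    fix i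
    have "(\<forall>j. add_column T c (i, j) \<noteq> Some Beta) \<longleftrightarrow>
        c i \<noteq> Some Beta \<and> (\<forall>j. T (i, j) \<noteq> Some Beta)" (is "?l \<longleftrightarrow> ?r")
    proof
      assume l: ?l
      have "T (i, j) \<noteq> Some Beta" for j
        using l[rule_format, of "Suc j"] T0(1) by (cases "j = 0") (auto simp: add_column_def)
      then show ?r using l[rule_format, of 1] by (auto simp: add_column_def)
    qed (auto simp: add_column_def)
    then show "i \<in> beta_free_rows (Suc n) (add_column T c) \<longleftrightarrow> i \<in> ?F \<inter> {i. c i \<noteq> Some Beta}"
      using T0(2) unfolding beta_free_rows_def by (cases "i = Suc n") auto
  qed
  then have "x ^ card (beta_free_rows (Suc n) (add_column T c)) =
      (\<Prod>i\<in>?F. if c i \<noteq> Some Beta then x else 1)"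
    by (simp only: prod.If_cases[OF finF]) simp
  moreover have "symbol_weight \<alpha> \<beta> s * (if s \<noteq> Some Beta then x else 1) = row_weight \<alpha> \<beta> x s" for s
    by (cases "(\<alpha>, \<beta>, s)" rule: symbol_weight.cases) auto
  ultimately show ?thesis
    by (simp only: w mult.assoc prod.distrib[symmetric])
qed

text \<open>Summing over the first column replaces \<open>x\<close> by \<open>x + \<beta>\<close> in
  the sum for size \<open>n\<close>, so the induction must keep \<open>x\<close> arbitrary. The case
  \<open>x = 1\<close> gives the partition function.\<close>

lemma weighted_sum_beta_free_rows:
  "(\<Sum>T\<in>ab_staircase_tableaux n. tableau_weight \<alpha> \<beta> T * x ^ card (beta_free_rows n T)) =
    (\<Prod>k<n. \<alpha> * (x + real k * \<beta>) + \<beta>)"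
proof (induction n arbitrary: x)
  case 0
  have "ab_staircase_tableaux 0 = {Map.empty}"
  proof -
    have "staircase_boxes 0 = {}" by (auto simp: staircase_boxes_def)
    then show ?thesis by (auto simp: ab_staircase_tableaux_def)
  qed
  then show ?case by (simp add: beta_free_rows_def tableau_weight_def)
next
  case (Suc n)
  let ?B = "\<lambda>T. bottom_columns (Suc n) (beta_free_rows n T)"
  have lt: "\<forall>i\<in>beta_free_rows n T. i < Suc n" for T
    by (auto simp: beta_free_rows_def)
  have finB: "finite (?B T)" for T
    unfolding bottom_columns_def
    by (rule finite_subset[OF _ finite_alpha_columns[of "insert (Suc n) (beta_free_rows n T)"]])
      (auto simp: finite_beta_free_rows)
  \<comment> \<open>The term subtracted in \<open>sum_columns\<close> cancels the contribution of
    the column whose lowest box holds \<alpha>.\<close>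
  have B: "(\<Sum>c\<in>?B T. \<Prod>i\<in>insert (Suc n) (beta_free_rows n T). row_weight \<alpha> \<beta> x (c i)) =
      (\<alpha> * x + \<beta>) * (x + \<beta>) ^ card (beta_free_rows n T)" for T
    unfolding bottom_columns_def sum_columns_nonempty_max[OF finite_beta_free_rows lt]
    by (simp add: sum_columns[OF finite_beta_free_rows])
  have "(\<Sum>T\<in>ab_staircase_tableaux (Suc n).
        tableau_weight \<alpha> \<beta> T * x ^ card (beta_free_rows (Suc n) T)) =
      (\<Sum>(T, c)\<in>Sigma (ab_staircase_tableaux n) ?B. tableau_weight \<alpha> \<beta> T *
        (\<Prod>i\<in>insert (Suc n) (beta_free_rows n T). row_weight \<alpha> \<beta> x (c i)))"
    unfolding sum.reindex_bij_betw[OF bij_betw_add_column[of n], symmetric]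
    by (rule sum.cong) (auto simp: weight_add_column)
  also have "\<dots> = (\<Sum>T\<in>ab_staircase_tableaux n. \<Sum>c\<in>?B T. tableau_weight \<alpha> \<beta> T *
        (\<Prod>i\<in>insert (Suc n) (beta_free_rows n T). row_weight \<alpha> \<beta> x (c i)))"
    by (rule sum.Sigma[symmetric]) (use finB finite_ab_staircase_tableaux in auto)
  also have "\<dots> = (\<alpha> * x + \<beta>) *
      (\<Sum>T\<in>ab_staircase_tableaux n. tableau_weight \<alpha> \<beta> T * (x + \<beta>) ^ card (beta_free_rows n T))"
    by (simp only: sum_distrib_left[symmetric] B) (simp add: sum_distrib_left mult_ac)
  also have "\<dots> = (\<Prod>k<Suc n. \<alpha> * (x + real k * \<beta>) + \<beta>)"
    unfolding Suc.IH prod.lessThan_Suc_shift by (simp add: algebra_simps)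
  finally show ?case .
qed

definition partition_function :: "real \<Rightarrow> real \<Rightarrow> nat \<Rightarrow> real" where
  "partition_function \<alpha> \<beta> n = (\<Sum>T\<in>ab_staircase_tableaux n. tableau_weight \<alpha> \<beta> T)"

lemma partition_function_eq_prod:
  "partition_function \<alpha> \<beta> n = (\<Prod>k<n. \<alpha> + \<beta> + real k * (\<alpha> * \<beta>))"
  using weighted_sum_beta_free_rows[of \<alpha> \<beta> 1 n]
  by (simp add: partition_function_def algebra_simps)

section \<open>Filled boxes on the second diagonal\<close>

definition skip :: "nat \<Rightarrow> nat \<Rightarrow> nat" where
  "skip r i = (if i < r then i else Suc i)"

text \<open>\<open>skip r\<close> enumerates increasingly the numbers other than \<open>r\<close>,
  renumbering lines around an inserted one; this undoes it.\<close>

definition unskip :: "nat \<Rightarrow> nat \<Rightarrow> nat" where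
  "unskip r i = (if i < r then i else i - 1)"

lemma skip_neq [simp]: "skip r i \<noteq> r" "r \<noteq> skip r i"
  by (auto simp: skip_def)

lemma unskip_skip [simp]: "unskip r (skip r i) = i"
  by (auto simp: skip_def unskip_def)

lemma skip_less_iff [simp]: "skip r i < skip r i' \<longleftrightarrow> i < i'"
  by (auto simp: skip_def)

lemma skip_eq_iff [simp]: "skip r i = skip r i' \<longleftrightarrow> i = i'"
  by (auto simp: skip_def)

lemma skip_cases:
  obtains "i = r" | i' where "i = skip r i'"
proof (cases "i < r")
  case True
  then show ?thesis using that(2)[of i] by (simp add: skip_def)
next
  case False
  then show ?thesis using that(1) that(2)[of "i - 1"] by (cases "i = r") (auto simp: skip_def)
qed

text \<open>The two new symbols are those forced by a filled box at \<open>(r - 1, s - 1)\<close>.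
  Writing \<open>Suc k = s\<close> and \<open>Suc i = r\<close> avoids truncated
  subtraction.\<close>

definition add_corner :: "nat \<Rightarrow> nat \<Rightarrow> (nat \<times> nat \<rightharpoonup> symbol) \<Rightarrow> (nat \<times> nat \<rightharpoonup> symbol)" where
  "add_corner r s T = (\<lambda>(i, k).
     if i = r then (if Suc k = s then Some Beta else None)
     else if k = s then (if Suc i = r then Some Alpha else None)
     else T (unskip r i, unskip s k))"

lemma add_corner_simps [simp]:
  "add_corner r s T (skip r i, skip s k) = T (i, k)"
  "add_corner r s T (r, k) = (if Suc k = s then Some Beta else None)"
  "i \<noteq> r \<Longrightarrow> add_corner r s T (i, s) = (if Suc i = r then Some Alpha else None)"
  by (auto simp: add_corner_def)

text \<open>Throughout, rows \<open>r - 1, r\<close> and columns \<open>s - 1, s\<close> meet in the corner: \<open>(r - 1, s - 1)\<close>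
  is a box of the second diagonal of a tableau of size \<open>n + 1\<close>, since \<open>r + s = n + 3\<close>.\<close>

lemma add_corner_in_tableaux:
  assumes T: "T \<in> ab_staircase_tableaux n" and rs: "r + s = n + 3" "2 \<le> r" "2 \<le> s"
  shows "add_corner r s T \<in> ab_staircase_tableaux (Suc n)"
    and "add_corner r s T (r - 1, s - 1) \<noteq> None"
proof -
  note TD = ab_staircase_tableauxD[OF T]
  let ?T = "add_corner r s T"
  \<comment> \<open>The box \<open>(r - 1, s - 1)\<close> lies on the main diagonal of
    \<open>T\<close>, hence is filled, and the insertion does not move it.\<close>
  have sk: "skip r (r - 1) = r - 1" "skip s (s - 1) = s - 1" using rs by (auto simp: skip_def)
  have "T (r - 1, s - 1) \<noteq> None" using rs by (intro TD(4)) auto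
  then show "?T (r - 1, s - 1) \<noteq> None"
    using add_corner_simps(1)[of r s T "r - 1" "s - 1"] unfolding sk by metis
  show "?T \<in> ab_staircase_tableaux (Suc n)"
  proof (rule ab_staircase_tableauxI)
    fix i k assume a: "?T (i, k) \<noteq> None"
    show "1 \<le> i \<and> 1 \<le> k \<and> i + k \<le> Suc n + 1"
    proof (cases i r rule: skip_cases)
      case 1
      then show ?thesis using a rs by (auto split: if_splits)
    next
      case i: (2 i')
      show ?thesis
      proof (cases k s rule: skip_cases)
        case 1
        then show ?thesis using a rs i by (auto split: if_splits)
      next
        case k: (2 k')
        have "T (i', k') \<noteq> None" using a by (simp add: i k)
        from TD(1)[OF this] show ?thesis using rs by (auto simp: i k skip_def)
      qed
    qed
  next
    fix i k i' assume a: "?T (i, k) = Some Alpha" "i' < i"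
    show "?T (i', k) = None"
    proof (cases i r rule: skip_cases)
      case 1
      then show ?thesis using a by (auto split: if_splits)
    next
      case i: (2 j)
      show ?thesis
      proof (cases k s rule: skip_cases)
        case 1
        then show ?thesis using a rs i by (auto split: if_splits)
      next
        case k: (2 k')
        have Ta: "T (j, k') = Some Alpha" using a by (simp add: i k)
        show ?thesis
        proof (cases i' r rule: skip_cases)
          case 1
          then have "r \<le> j" using a(2) by (auto simp: i skip_def split: if_splits)
          \<comment> \<open>A box of \<open>T\<close> in row \<open>r\<close> or below lies left of
            column \<open>s - 1\<close>, so the new \<beta> is not above this \<alpha>.\<close>
          then have "Suc k \<noteq> s" using TD(1)[of j k'] Ta rs by (auto simp: k skip_def split: if_splits)
          then show ?thesis by (simp add: 1)
        next
          case (2 j')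
          then have "j' < j" using a(2) by (simp add: i)
          then show ?thesis using TD(2)[OF Ta] by (simp add: 2 k)
        qed
      qed
    qed
  next
    fix i k k' assume a: "?T (i, k) = Some Beta" "k' < k"
    show "?T (i, k') = None"
    proof (cases i r rule: skip_cases)
      case 1
      then show ?thesis using a by (auto split: if_splits)
    next
      case i: (2 j)
      show ?thesis
      proof (cases k s rule: skip_cases)
        case 1
        then show ?thesis using a rs i by (auto split: if_splits)
      next
        case k: (2 l)
        have Tb: "T (j, l) = Some Beta" using a by (simp add: i k)
        show ?thesis
        proof (cases k' s rule: skip_cases)
          case 1
          then have "s \<le> l" using a(2) by (auto simp: k skip_def split: if_splits)
          \<comment> \<open>Likewise, a \<beta> in column \<open>s\<close> or further right lies
            above row \<open>r - 1\<close>, so the new \<alpha> is not in its row.\<close>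
          then have "Suc i \<noteq> r" using TD(1)[of j l] Tb rs by (auto simp: i skip_def split: if_splits)
          then show ?thesis by (simp add: 1 i)
        next
          case (2 l')
          then have "l' < l" using a(2) by (simp add: k)
          then show ?thesis using TD(3)[OF Tb] by (simp add: 2 i)
        qed
      qed
    qed
  next
    fix i k :: nat assume a: "1 \<le> i" "1 \<le> k" "i + k = Suc n + 1"
    show "?T (i, k) \<noteq> None"
    proof (cases i r rule: skip_cases)
      case 1
      then show ?thesis using a rs by auto
    next
      case i: (2 j)
      show ?thesis
      proof (cases k s rule: skip_cases)
        case 1
        then show ?thesis using a rs i by auto
      next
        case k: (2 l)
        have "T (j, l) \<noteq> None"
          using a rs by (intro TD(4)) (auto simp: i k skip_def split: if_splits)
        then show ?thesis by (simp add: i k)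
      qed
    qed
  qed
qed

text \<open>The boxes below and to the right of \<open>(r - 1, s - 1)\<close> are on the main
  diagonal, hence filled. An \<alpha> below or a \<beta> to the right would empty
  \<open>(r - 1, s - 1)\<close>, so they hold \<beta> and \<alpha>, which in turn empty the rest of
  row \<open>r\<close> and column \<open>s\<close>.\<close>

lemma corner_forced:
  assumes T: "T \<in> ab_staircase_tableaux (Suc n)" and rs: "r + s = n + 3" "2 \<le> r" "2 \<le> s"
    and ne: "T (r - 1, s - 1) \<noteq> None"
  shows "T (r, k) = (if Suc k = s then Some Beta else None)"
    and "T (i, s) = (if Suc i = r then Some Alpha else None)"
proof -
  note TD = ab_staircase_tableauxD[OF T]
  have "T (r, s - 1) \<noteq> None" "T (r - 1, s) \<noteq> None"
    by (rule TD(4); use rs in simp)+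
  moreover have "T (r, s - 1) \<noteq> Some Alpha"
    using TD(2)[of r "s - 1" "r - 1"] ne rs by auto
  moreover have "T (r - 1, s) \<noteq> Some Beta"
    using TD(3)[of "r - 1" s "s - 1"] ne rs by auto
  ultimately have b: "T (r, s - 1) = Some Beta" and a: "T (r - 1, s) = Some Alpha"
    by (metis option.exhaust symbol.exhaust)+
  show "T (r, k) = (if Suc k = s then Some Beta else None)"
    using b TD(3)[OF b, of k] TD(1)[of r k] rs
    by (cases "k < s - 1"; cases "T (r, k)") auto
  show "T (i, s) = (if Suc i = r then Some Alpha else None)"
    using a TD(2)[OF a, of i] TD(1)[of i s] rs
    by (cases "i < r - 1"; cases "T (i, s)") auto
qed

lemma remove_corner_in_tableaux:
  assumes T: "T \<in> ab_staircase_tableaux (Suc n)" and rs: "r + s = n + 3" "2 \<le> r" "2 \<le> s"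
    and ne: "T (r - 1, s - 1) \<noteq> None"
  shows "(\<lambda>(i, k). T (skip r i, skip s k)) \<in> ab_staircase_tableaux n"
proof -
  note TD = ab_staircase_tableauxD[OF T]
  \<comment> \<open>The renumbering sends the main diagonal into the larger main diagonal, except
    for \<open>(r - 1, s - 1)\<close>, which is filled by hypothesis.\<close>
  have main: "T (skip r i, skip s k) \<noteq> None"
    if ik: "1 \<le> i" "1 \<le> k" "i + k = n + 1" for i k
  proof (cases "i = r - 1")
    case True
    then have "k = s - 1" using ik rs by simp
    then show ?thesis using ne rs True by (simp add: skip_def)
  next
    case False
    show ?thesis
      using ik rs False by (intro TD(4)) (auto simp: skip_def)
  qed
  have shape: "1 \<le> i \<and> 1 \<le> k \<and> i + k \<le> n + 1" if "T (skip r i, skip s k) \<noteq> None" for i k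
  proof -
    have "1 \<le> skip r i \<and> 1 \<le> skip s k \<and> skip r i + skip s k \<le> n + 2"
      using TD(1)[OF that] by simp
    then show ?thesis using rs by (auto simp: skip_def split: if_splits)
  qed
  show ?thesis
  proof (rule ab_staircase_tableauxI, goal_cases)
    case (1 i j)
    then show ?case using shape[of i j] by simp
  next
    case (2 i j i')
    then show ?case using TD(2)[of "skip r i" "skip s j" "skip r i'"] by simp
  next
    case (3 i j j')
    then show ?case using TD(3)[of "skip r i" "skip s j" "skip s j'"] by simp
  next
    case (4 i j)
    then show ?case using main[of i j] by simp
  qed
qed

text \<open>By \<open>corner_forced\<close> the contents of row \<open>r\<close> and column
  \<open>s\<close> are determined, so deleting them loses no information.\<close>

lemma bij_betw_add_corner:
  assumes rs: "r + s = n + 3" "2 \<le> r" "2 \<le> s"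
  shows "bij_betw (add_corner r s) (ab_staircase_tableaux n)
    {T \<in> ab_staircase_tableaux (Suc n). T (r - 1, s - 1) \<noteq> None}"
proof (rule bij_betw_byWitness[where f' = "\<lambda>T (i, k). T (skip r i, skip s k)"])
  show "\<forall>T\<in>ab_staircase_tableaux n. (\<lambda>(i, k). add_corner r s T (skip r i, skip s k)) = T"
    by auto
  show "\<forall>T\<in>{T \<in> ab_staircase_tableaux (Suc n). T (r - 1, s - 1) \<noteq> None}.
      add_corner r s (\<lambda>(i, k). T (skip r i, skip s k)) = T"
  proof (intro ballI ext, clarify)
    fix T i k y assume T: "T \<in> ab_staircase_tableaux (Suc n)" "T (r - 1, s - 1) = Some y"
    note forced = corner_forced[OF T(1) rs, unfolded T(2), OF option.distinct(2)]
    show "add_corner r s (\<lambda>(i, k). T (skip r i, skip s k)) (i, k) = T (i, k)"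
      by (cases i r rule: skip_cases; cases k s rule: skip_cases) (simp_all add: forced)
  qed
  show "add_corner r s ` ab_staircase_tableaux n \<subseteq>
      {T \<in> ab_staircase_tableaux (Suc n). T (r - 1, s - 1) \<noteq> None}"
    using add_corner_in_tableaux[OF _ rs] by blast
  show "(\<lambda>T (i, k). T (skip r i, skip s k)) `
      {T \<in> ab_staircase_tableaux (Suc n). T (r - 1, s - 1) \<noteq> None} \<subseteq> ab_staircase_tableaux n"
    using remove_corner_in_tableaux[OF _ rs] by blast
qed

lemma weight_add_corner:
  assumes T: "T \<in> ab_staircase_tableaux n" and rs: "2 \<le> r" "2 \<le> s"
  shows "tableau_weight \<alpha> \<beta> (add_corner r s T) = \<alpha> * \<beta> * tableau_weight \<alpha> \<beta> T"
proof -
  let ?S = "map_prod (skip r) (skip s)" and ?C = "{(r, s - 1), (r - 1, s)}"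
  have fin: "finite (dom T)" using T by (rule finite_dom_tableau)
  have "dom (add_corner r s T) \<subseteq> ?S ` dom T \<union> ?C"
  proof
    fix b assume b: "b \<in> dom (add_corner r s T)"
    obtain i k where ik: "b = (i, k)" by (cases b)
    show "b \<in> ?S ` dom T \<union> ?C"
    proof (cases i r rule: skip_cases)
      case 1
      then show ?thesis using b by (auto simp: ik split: if_splits)
    next
      case i: (2 i')
      show ?thesis
      proof (cases k s rule: skip_cases)
        case 1
        then show ?thesis using b i rs by (auto simp: ik split: if_splits)
      next
        case k: (2 k')
        then have "(i', k') \<in> dom T" using b by (auto simp: ik i)
        then have "?S (i', k') \<in> ?S ` dom T" by (rule imageI)
        then show ?thesis by (simp add: ik i k)
      qed
    qed
  qed
  then have "tableau_weight \<alpha> \<beta> (add_corner r s T) =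
      (\<Prod>b\<in>?S ` dom T \<union> ?C. symbol_weight \<alpha> \<beta> (add_corner r s T b))"
    by (rule tableau_weight_eq_prod[rotated]) (use fin in auto)
  also have "\<dots> = (\<Prod>b\<in>?S ` dom T. symbol_weight \<alpha> \<beta> (add_corner r s T b)) *
      (\<Prod>b\<in>?C. symbol_weight \<alpha> \<beta> (add_corner r s T b))"
    using fin by (intro prod.union_disjoint) auto
  also have "(\<Prod>b\<in>?S ` dom T. symbol_weight \<alpha> \<beta> (add_corner r s T b)) =
      (\<Prod>b\<in>dom T. symbol_weight \<alpha> \<beta> (T b))"
    by (subst prod.reindex) (auto simp: inj_on_def intro!: prod.cong)
  also have "\<dots> = tableau_weight \<alpha> \<beta> T"
    by (rule tableau_weight_eq_prod[symmetric]) (use fin in auto)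
  also have "(\<Prod>b\<in>?C. symbol_weight \<alpha> \<beta> (add_corner r s T b)) = \<alpha> * \<beta>"
    using rs by (subst prod.insert) auto
  finally show ?thesis by simp
qed

section \<open>Total weight of the tableaux with prescribed boxes of the second diagonal
  filled\<close>

definition prescribed_weight :: "real \<Rightarrow> real \<Rightarrow> nat \<Rightarrow> nat set \<Rightarrow> real" where
  "prescribed_weight \<alpha> \<beta> n J =
    (\<Sum>T | T \<in> ab_staircase_tableaux n \<and> (\<forall>j\<in>J. T (n - j, j) \<noteq> None). tableau_weight \<alpha> \<beta> T)"

text \<open>The two filled boxes force different symbols in the diagonal box
  \<open>(n - j, Suc j)\<close>: \<alpha> as the right neighbour of one, \<beta> as the lower
  neighbour of the other.\<close>

lemma prescribed_weight_adjacent: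
  assumes "j \<in> J" "Suc j \<in> J" "1 \<le> j" "Suc j < n"
  shows "prescribed_weight \<alpha> \<beta> n J = 0"
proof -
  have "\<not> (\<forall>j\<in>J. T (n - j, j) \<noteq> None)" if T: "T \<in> ab_staircase_tableaux n" for T
  proof
    assume ne: "\<forall>j\<in>J. T (n - j, j) \<noteq> None"
    obtain m where n: "n = Suc m" using assms(4) by (cases n) auto
    have "T (n - j, j) \<noteq> None" "T (n - Suc j, Suc j) \<noteq> None" using ne assms(1,2) by blast+
    moreover have "T (n - j, Suc j) = Some Alpha"
      using corner_forced(2)[of T m "Suc (n - j)" "Suc j" "n - j"] T n assms calculation by auto
    moreover have "T (n - j, Suc j) = Some Beta"
      using corner_forced(1)[of T m "n - j" "Suc (Suc j)" "Suc j"] T n assms calculation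
      by (auto simp: numeral_eq_Suc)
    ultimately show False by simp
  qed
  then have "{T. T \<in> ab_staircase_tableaux n \<and> (\<forall>j\<in>J. T (n - j, j) \<noteq> None)} = {}"
    by blast
  then show ?thesis unfolding prescribed_weight_def by (simp only: sum.empty)
qed

text \<open>Inserting the corner for column \<open>j\<close> multiplies the weight by
  \<open>\<alpha> * \<beta>\<close>. The gap \<open>Suc i < j\<close> ensures that the boxes of
  \<open>J\<close> keep their columns and move down one row, from the second diagonal of size
  \<open>n\<close> to that of size \<open>Suc n\<close>.\<close>

lemma prescribed_weight_insert:
  assumes j: "1 \<le> j" "j \<le> n" and J: "\<forall>i\<in>J. Suc i < j"
  shows "prescribed_weight \<alpha> \<beta> (Suc n) (insert j J) = \<alpha> * \<beta> * prescribed_weight \<alpha> \<beta> n J"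
proof -
  define r s where "r = Suc (Suc n) - j" and "s = Suc j"
  have rs: "r + s = n + 3" "2 \<le> r" "2 \<le> s" using j by (auto simp: r_def s_def)
  have eq: "add_corner r s T (Suc n - i, i) = T (n - i, i)" if "i \<in> J" for i T
  proof -
    have "Suc n - i = skip r (n - i)" "i = skip s i"
      using J that j by (auto simp: skip_def r_def s_def)
    then show ?thesis using add_corner_simps(1)[of r s T "n - i" i] by simp
  qed
  have "bij_betw (add_corner r s)
      {T \<in> ab_staircase_tableaux n. \<forall>i\<in>J. T (n - i, i) \<noteq> None}
      {T \<in> {T \<in> ab_staircase_tableaux (Suc n). T (r - 1, s - 1) \<noteq> None}.
        \<forall>i\<in>J. T (Suc n - i, i) \<noteq> None}"
    by (rule bij_betw_Collect[OF bij_betw_add_corner[OF rs]]) (simp add: eq)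
  moreover have "{T \<in> {T \<in> ab_staircase_tableaux (Suc n). T (r - 1, s - 1) \<noteq> None}.
        \<forall>i\<in>J. T (Suc n - i, i) \<noteq> None} =
      {T \<in> ab_staircase_tableaux (Suc n). \<forall>i\<in>insert j J. T (Suc n - i, i) \<noteq> None}"
    using j by (auto simp: r_def s_def Suc_diff_le)
  ultimately have bij: "bij_betw (add_corner r s)
      {T \<in> ab_staircase_tableaux n. \<forall>i\<in>J. T (n - i, i) \<noteq> None}
      {T \<in> ab_staircase_tableaux (Suc n). \<forall>i\<in>insert j J. T (Suc n - i, i) \<noteq> None}"
    by simp
  show ?thesis
    unfolding prescribed_weight_def sum.reindex_bij_betw[OF bij, symmetric] sum_distrib_left
    by (rule sum.cong) (auto simp: weight_add_corner[OF _ rs(2,3)])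
qed

lemma sum_Pow_insert:
  assumes "finite A" "a \<notin> A"
  shows "(\<Sum>J\<in>Pow (insert a A). f J) = (\<Sum>J\<in>Pow A. f J) + (\<Sum>J\<in>Pow A. f (insert a J))"
proof -
  have "inj_on (insert a) (Pow A)" using assms(2) by (intro inj_onI) (auto simp: insert_ident)
  moreover have "Pow A \<inter> insert a ` Pow A = {}" using assms(2) by auto
  ultimately show ?thesis
    using assms(1) by (simp add: Pow_insert sum.union_disjoint sum.reindex)
qed

text \<open>Split by whether \<open>J\<close> contains the last column \<open>Suc (Suc m)\<close>.
  If so, sets also containing \<open>Suc m\<close> contribute 0, and for the others the corner can
  be removed.\<close>

lemma sum_prescribed_weight_rec:
  fixes z :: complex
  assumes "Suc m < n"
  shows "(\<Sum>J\<in>Pow {1..Suc (Suc m)}. z ^ card J * of_real (prescribed_weight \<alpha> \<beta> (Suc n) J)) =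
    (\<Sum>J\<in>Pow {1..Suc m}. z ^ card J * of_real (prescribed_weight \<alpha> \<beta> (Suc n) J)) +
    z * of_real (\<alpha> * \<beta>) * (\<Sum>J\<in>Pow {1..m}. z ^ card J * of_real (prescribed_weight \<alpha> \<beta> n J))"
proof -
  let ?f = "\<lambda>n J. z ^ card J * complex_of_real (prescribed_weight \<alpha> \<beta> n J)"
  let ?a = "Suc (Suc m)"
  have ins: "{1..?a} = insert ?a {1..Suc m}" by auto
  have "(\<Sum>J\<in>Pow {1..Suc m}. ?f (Suc n) (insert ?a J)) =
      (\<Sum>J\<in>Pow {1..m}. ?f (Suc n) (insert ?a J))"
  proof (rule sum.mono_neutral_right)
    show "\<forall>J\<in>Pow {1..Suc m} - Pow {1..m}. ?f (Suc n) (insert ?a J) = 0"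
    proof
      fix J assume J: "J \<in> Pow {1..Suc m} - Pow {1..m}"
      then have "Suc m \<in> J" by (auto simp: subset_iff) (metis le_SucE)
      then show "?f (Suc n) (insert ?a J) = 0"
        using assms by (subst prescribed_weight_adjacent[of "Suc m"]) auto
    qed
  qed auto
  also have "\<dots> = (\<Sum>J\<in>Pow {1..m}. z * of_real (\<alpha> * \<beta>) * ?f n J)"
  proof (rule sum.cong)
    fix J assume J: "J \<in> Pow {1..m}"
    then have "finite J" "?a \<notin> J" by (auto intro: finite_subset)
    moreover have "prescribed_weight \<alpha> \<beta> (Suc n) (insert ?a J) =
        \<alpha> * \<beta> * prescribed_weight \<alpha> \<beta> n J"
      using J assms by (intro prescribed_weight_insert) auto
    ultimately show "?f (Suc n) (insert ?a J) = z * of_real (\<alpha> * \<beta>) * ?f n J"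
      by simp
  qed simp
  finally have "(\<Sum>J\<in>Pow {1..Suc m}. ?f (Suc n) (insert ?a J)) =
      z * of_real (\<alpha> * \<beta>) * (\<Sum>J\<in>Pow {1..m}. ?f n J)"
    by (simp only: sum_distrib_left)
  then show ?thesis
    unfolding ins by (subst sum_Pow_insert) auto
qed

text \<open>\<open>(m + 1 - r) choose r\<close> counts the \<open>r\<close>-subsets of \<open>{1..m}\<close> without adjacent elements;
  the truncated subtraction is harmless, as \<open>0 choose r\<close> vanishes for \<open>r > 0\<close>.\<close>

lemma sum_prescribed_weight:
  fixes z :: complex
  assumes "m < n"
  shows "(\<Sum>J\<in>Pow {1..m}. z ^ card J * of_real (prescribed_weight \<alpha> \<beta> n J)) =
    (\<Sum>r\<le>n. of_nat ((Suc m - r) choose r) * (z * of_real (\<alpha> * \<beta>)) ^ r *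
      of_real (partition_function \<alpha> \<beta> (n - r)))"
  using assms
proof (induction m arbitrary: n rule: less_induct)
  case (less m)
  let ?S = "\<lambda>n m. \<Sum>J\<in>Pow {1..m}. z ^ card J * complex_of_real (prescribed_weight \<alpha> \<beta> n J)"
  let ?Z = "\<lambda>n. complex_of_real (partition_function \<alpha> \<beta> n)"
  let ?w = "z * complex_of_real (\<alpha> * \<beta>)"
  have empty: "prescribed_weight \<alpha> \<beta> k {} = partition_function \<alpha> \<beta> k" for k
    by (simp add: prescribed_weight_def partition_function_def)
  obtain n' where n: "n = Suc n'" using less.prems by (cases n) auto
  \<comment> \<open>The recursion goes back two steps, so there are two base cases.\<close>
  consider "m = 0" | "m = 1" | m' where "m = Suc (Suc m')"
    by (metis One_nat_def not0_implies_Suc)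
  then show ?case
  proof cases
    case 1
    have "(\<Sum>r\<le>n'. of_nat ((Suc 0 - Suc r) choose Suc r) * ?w ^ Suc r * ?Z (n' - r)) = 0"
      by (intro sum.neutral) auto
    then show ?thesis
      by (simp add: 1 empty n sum.atMost_Suc_shift del: sum.atMost_Suc power_Suc of_real_mult)
  next
    case 2
    obtain n'' where n': "n' = Suc n''" using less.prems 2 n by (cases n') auto
    have "(\<Sum>r\<le>n''. of_nat ((Suc (Suc 0) - Suc (Suc r)) choose Suc (Suc r)) *
        ?w ^ Suc (Suc r) * ?Z (n'' - r)) = 0"
      by (intro sum.neutral) auto
    moreover have "prescribed_weight \<alpha> \<beta> n {1} = \<alpha> * \<beta> * partition_function \<alpha> \<beta> n'"
      using prescribed_weight_insert[of 1 n' "{}" \<alpha> \<beta>] by (simp add: n n' empty)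
    moreover have "Pow {1..1::nat} = {{}, {1}}" by auto
    ultimately show ?thesis
      by (simp add: 2 empty n n' sum.atMost_Suc_shift del: power_Suc sum.atMost_Suc)
  next
    case (3 m')
    \<comment> \<open>Pascal's rule while the subtractions are genuine; beyond that all three
      binomial coefficients vanish.\<close>
    have choose: "(Suc m - Suc r) choose Suc r =
        ((Suc (Suc m') - Suc r) choose Suc r) + ((Suc m' - r) choose r)" for r
    proof (cases "r \<le> Suc m'")
      case True
      then have "Suc m - Suc r = Suc (Suc m' - r)" using 3 by simp
      then show ?thesis by (simp add: add.commute)
    next
      case False
      then show ?thesis using 3 by (cases r) auto
    qed
    have "?S n m = ?S n (Suc m') + ?w * ?S n' m'"
      unfolding 3 n using less.prems 3 n
      by (subst sum_prescribed_weight_rec) auto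
    also have "?S n (Suc m') =
        (\<Sum>r\<le>n. of_nat ((Suc (Suc m') - r) choose r) * ?w ^ r * ?Z (n - r))"
      using less.prems 3 by (intro less.IH) auto
    also have "\<dots> = ?Z n +
        (\<Sum>r\<le>n'. of_nat ((Suc (Suc m') - Suc r) choose Suc r) * ?w ^ Suc r * ?Z (n' - r))"
      by (simp add: n sum.atMost_Suc_shift del: sum.atMost_Suc)
    also have "?S n' m' = (\<Sum>r\<le>n'. of_nat ((Suc m' - r) choose r) * ?w ^ r * ?Z (n' - r))"
      using less.prems 3 n by (intro less.IH) auto
    also have "?Z n +
        (\<Sum>r\<le>n'. of_nat ((Suc (Suc m') - Suc r) choose Suc r) * ?w ^ Suc r * ?Z (n' - r)) +
        ?w * (\<Sum>r\<le>n'. of_nat ((Suc m' - r) choose r) * ?w ^ r * ?Z (n' - r)) =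
      ?Z n + (\<Sum>r\<le>n'. of_nat ((Suc m - Suc r) choose Suc r) * ?w ^ Suc r * ?Z (n' - r))"
      unfolding choose
      by (simp only: sum_distrib_left add.assoc sum.distrib[symmetric] of_nat_add
          power_Suc) (simp add: algebra_simps)
    also have "\<dots> = (\<Sum>r\<le>n. of_nat ((Suc m - r) choose r) * ?w ^ r * ?Z (n - r))"
      by (simp add: n sum.atMost_Suc_shift del: sum.atMost_Suc)
    finally show ?thesis .
  qed
qed

section \<open>The generating function of the number of symbols on the second diagonal\<close>

lemma power_card_eq_sum_Pow:
  fixes z :: "'a::comm_ring_1"
  assumes "finite A"
  shows "(1 + z) ^ card {a \<in> A. P a} = (\<Sum>J\<in>Pow A. z ^ card J * of_bool (\<forall>a\<in>J. P a))"
proof -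
  let ?B = "{a \<in> A. P a}"
  \<comment> \<open>One factor \<open>z + 1\<close> per element satisfying \<open>P\<close>;
    expanding chooses the subset that contributes \<open>z\<close>.\<close>
  have "(1 + z) ^ card ?B = (\<Prod>a\<in>?B. z + 1)" by (simp add: add.commute)
  also have "\<dots> = (\<Sum>J\<in>Pow ?B. z ^ card J)"
    using assms by (subst prod_add) auto
  also have "\<dots> = (\<Sum>J\<in>Pow ?B. z ^ card J * of_bool (\<forall>a\<in>J. P a))"
    by (rule sum.cong) auto
  also have "\<dots> = (\<Sum>J\<in>Pow A. z ^ card J * of_bool (\<forall>a\<in>J. P a))"
    by (rule sum.mono_neutral_left) (use assms in auto)
  finally show ?thesis .
qed

lemma second_diagonal_symbols_eq_card:
  "second_diagonal_symbols n T = card {j \<in> {1..n - 1}. T (n - j, j) \<noteq> None}"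
  unfolding second_diagonal_symbols_def
  by (simp add: of_bool_def sum.If_cases Int_def del: not_None_eq)

text \<open>Expanding around 1 turns the generating function into a sum over sets of boxes required
  to be filled, with no condition on the other boxes.\<close>

lemma sum_weight_power_second_diagonal:
  fixes z :: complex
  shows "(\<Sum>T\<in>ab_staircase_tableaux n.
      of_real (tableau_weight \<alpha> \<beta> T) * (1 + z) ^ second_diagonal_symbols n T) =
    (\<Sum>J\<in>Pow {1..n - 1}. z ^ card J * of_real (prescribed_weight \<alpha> \<beta> n J))"
proof -
  let ?w = "\<lambda>T. complex_of_real (tableau_weight \<alpha> \<beta> T)"
  let ?P = "\<lambda>T J. \<forall>j\<in>J. T (n - j, j) \<noteq> None"
  have "(\<Sum>T\<in>ab_staircase_tableaux n. ?w T * (1 + z) ^ second_diagonal_symbols n T) =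
      (\<Sum>T\<in>ab_staircase_tableaux n. \<Sum>J\<in>Pow {1..n - 1}. z ^ card J * (?w T * of_bool (?P T J)))"
    unfolding second_diagonal_symbols_eq_card power_card_eq_sum_Pow[OF finite_atLeastAtMost]
      sum_distrib_left
    by (intro sum.cong refl) (simp add: mult_ac)
  also have "\<dots> = (\<Sum>J\<in>Pow {1..n - 1}. z ^ card J *
      (\<Sum>T\<in>ab_staircase_tableaux n. ?w T * of_bool (?P T J)))"
    unfolding sum_distrib_left by (rule sum.swap)
  also have "\<dots> = (\<Sum>J\<in>Pow {1..n - 1}. z ^ card J * of_real (prescribed_weight \<alpha> \<beta> n J))"
  proof (intro sum.cong refl arg_cong2[of _ _ _ _ "(*)"])
    fix J
    have "(\<Sum>T\<in>ab_staircase_tableaux n. ?w T * of_bool (?P T J)) =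
        (\<Sum>T\<in>ab_staircase_tableaux n. if ?P T J then ?w T else 0)"
      by (rule sum.cong) auto
    also have "\<dots> = of_real (prescribed_weight \<alpha> \<beta> n J)"
      unfolding prescribed_weight_def of_real_sum
      by (subst sum.inter_filter[symmetric]) (auto simp: finite_ab_staircase_tableaux)
    finally show "(\<Sum>T\<in>ab_staircase_tableaux n. ?w T * of_bool (?P T J)) =
        of_real (prescribed_weight \<alpha> \<beta> n J)" .
  qed
  finally show ?thesis .
qed

lemma partition_function_pos:
  assumes "\<alpha> > 0" "\<beta> > 0"
  shows "partition_function \<alpha> \<beta> n > 0"
  unfolding partition_function_eq_prod
  using assms by (intro prod_pos) (auto intro!: add_pos_nonneg)

section \<open>Convergence of characteristic functions\<close>

text \<open>With z = \<open>iexp t - 1\<close>, the value of \<open>iexp\<close> at t X is (1 +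
  z)^X, so the characteristic function is the normalised generating function.\<close>

lemma char_random_tableau:
  assumes "\<alpha> > 0" "\<beta> > 0" "n > 0"
  shows "char (distr (measure_pmf (random_tableau n \<alpha> \<beta>)) borel
      (\<lambda>T. real (second_diagonal_symbols n T))) t =
    (\<Sum>r\<le>n. of_nat ((n - r) choose r) * ((iexp t - 1) * of_real (\<alpha> * \<beta>)) ^ r *
      of_real (partition_function \<alpha> \<beta> (n - r))) / of_real (partition_function \<alpha> \<beta> n)"
proof -
  let ?Z = "partition_function \<alpha> \<beta>" and ?A = "ab_staircase_tableaux n"
  have "char (distr (measure_pmf (random_tableau n \<alpha> \<beta>)) borel
      (\<lambda>T. real (second_diagonal_symbols n T))) t =
      (CLINT T|measure_pmf (random_tableau n \<alpha> \<beta>). iexp (t * real (second_diagonal_symbols n T)))"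
    unfolding char_def by (subst integral_distr) auto
  also have "\<dots> = (\<Sum>T\<in>?A. pmf (random_tableau n \<alpha> \<beta>) T *\<^sub>R iexp (t * real (second_diagonal_symbols n T)))"
    using assms
    by (intro integral_measure_pmf)
      (auto simp: finite_ab_staircase_tableaux set_pmf_iff pmf_random_tableau split: if_splits)
  also have "\<dots> = (\<Sum>T\<in>?A. of_real (tableau_weight \<alpha> \<beta> T) * (1 + (iexp t - 1)) ^ second_diagonal_symbols n T) / of_real (?Z n)"
    unfolding sum_divide_distrib
  proof (rule sum.cong)
    fix T assume "T \<in> ?A"
    moreover have "iexp (t * real (second_diagonal_symbols n T)) = iexp t ^ second_diagonal_symbols n T"
      by (simp add: exp_of_nat_mult[symmetric] mult_ac)
    ultimately show "pmf (random_tableau n \<alpha> \<beta>) T *\<^sub>R iexp (t * real (second_diagonal_symbols n T)) =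
        of_real (tableau_weight \<alpha> \<beta> T) * (1 + (iexp t - 1)) ^ second_diagonal_symbols n T / of_real (?Z n)"
      using assms(1,2) by (simp add: pmf_random_tableau partition_function_def scaleR_conv_of_real)
  qed simp
  also have "\<dots> = (\<Sum>r\<le>n. of_nat ((n - r) choose r) * ((iexp t - 1) * of_real (\<alpha> * \<beta>)) ^ r *
      of_real (?Z (n - r))) / of_real (?Z n)"
    unfolding sum_weight_power_second_diagonal
    \<comment> \<open>Applied with \<open>n - 1\<close> for \<open>m\<close>; positivity of
      \<open>n\<close> gives \<open>m < n\<close> and \<open>Suc m = n\<close>.\<close>
    using assms(3) by (subst sum_prescribed_weight) auto
  finally show ?thesis .
qed

text \<open>The Poisson weights turn the integral into the exponential series at
  \<open>iexp t\<close> times \<open>exp (-1)\<close>; absolute convergence identifies integral and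
  series.\<close>

lemma char_poisson:
  "char (distr (measure_pmf (poisson_pmf 1)) borel real) t = exp (iexp t - 1)"
proof -
  have sums: "(\<lambda>k. (1 / fact k * exp (-1)) *\<^sub>R iexp (t * real k)) sums exp (iexp t - 1)"
  proof -
    have "(\<lambda>k. exp (-1) * (iexp t ^ k /\<^sub>R fact k)) sums (exp (-1) * exp (iexp t))"
      by (intro sums_mult exp_converges)
    moreover have "exp (-1) * (iexp t ^ k /\<^sub>R fact k) = (1 / fact k * exp (-1)) *\<^sub>R iexp (t * real k)" for k
      by (simp add: exp_of_nat_mult[symmetric] scaleR_conv_of_real mult_ac exp_of_real[symmetric] divide_inverse)
    ultimately show ?thesis by (simp add: exp_diff exp_minus field_simps)
  qed
  have norm: "norm ((1 / fact k * exp (-1)) *\<^sub>R iexp (t * real k)) = exp (-1) * (1 ^ k /\<^sub>R fact k)" for k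
    by (simp add: norm_mult divide_inverse)
  have "summable (\<lambda>k. norm ((1 / fact k * exp (-1)) *\<^sub>R iexp (t * real k)))"
    unfolding norm by (intro summable_mult sums_summable[OF exp_converges])
  then have int: "integrable (count_space UNIV) (\<lambda>k. (1 / fact k * exp (-1)) *\<^sub>R iexp (t * real k))"
    by (simp add: integrable_count_space_nat_iff)
  have "char (distr (measure_pmf (poisson_pmf 1)) borel real) t =
      (CLINT k|measure_pmf (poisson_pmf 1). iexp (t * real k))"
    unfolding char_def by (subst integral_distr) auto
  also have "\<dots> = (CLINT k|count_space UNIV. (1 / fact k * exp (-1)) *\<^sub>R iexp (t * real k))"
    unfolding measure_pmf_eq_density by (subst integral_density) auto
  also have "\<dots> = exp (iexp t - 1)"
    using sums_integral_count_space_nat[OF int] sums by (rule sums_unique2)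
  finally show ?thesis .
qed

section \<open>Binomial moments: product formula, bound and limit\<close>

lemma partition_function_ratio:
  assumes "\<alpha> > 0" "\<beta> > 0" "r \<le> n"
  shows "(\<alpha> * \<beta>) ^ r * partition_function \<alpha> \<beta> (n - r) / partition_function \<alpha> \<beta> n =
    (\<Prod>i<r. 1 / ((\<alpha> + \<beta>) / (\<alpha> * \<beta>) + real (n - Suc i)))"
  using assms(3)
proof (induction r)
  case 0
  then show ?case using partition_function_pos[OF assms(1,2), of n] by simp
next
  case (Suc r)
  \<comment> \<open>Each step strips the last factor from the product for the partition function of
    size \<open>n - r\<close> and divides it by \<open>\<alpha> * \<beta>\<close>.\<close>
  have "n - r = Suc (n - Suc r)" using Suc.prems by simp
  then have Z: "partition_function \<alpha> \<beta> (n - r) =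
      (\<alpha> + \<beta> + real (n - Suc r) * (\<alpha> * \<beta>)) * partition_function \<alpha> \<beta> (n - Suc r)"
    unfolding partition_function_eq_prod by simp
  have pos: "\<alpha> + \<beta> + real (n - Suc r) * (\<alpha> * \<beta>) > 0"
    using assms by (intro add_pos_nonneg) auto
  have "(\<alpha> * \<beta>) ^ Suc r * partition_function \<alpha> \<beta> (n - Suc r) / partition_function \<alpha> \<beta> n =
      ((\<alpha> * \<beta>) ^ r * partition_function \<alpha> \<beta> (n - r) / partition_function \<alpha> \<beta> n) *
      (\<alpha> * \<beta> / (\<alpha> + \<beta> + real (n - Suc r) * (\<alpha> * \<beta>)))"
    unfolding Z using pos by simp
  also have "\<alpha> * \<beta> / (\<alpha> + \<beta> + real (n - Suc r) * (\<alpha> * \<beta>)) =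
      1 / ((\<alpha> + \<beta>) / (\<alpha> * \<beta>) + real (n - Suc r))"
    using assms(1,2) by (simp add: field_simps)
  finally show ?case using Suc by simp
qed

text \<open>This is the expectation of \<open>X choose r\<close>, where \<open>X\<close> is the number of symbols on the second
  diagonal of the random tableau of size \<open>n\<close>.\<close>

definition binomial_moment :: "real \<Rightarrow> real \<Rightarrow> nat \<Rightarrow> nat \<Rightarrow> real" where
  "binomial_moment \<alpha> \<beta> n r =
    real ((n - r) choose r) * (\<alpha> * \<beta>) ^ r * partition_function \<alpha> \<beta> (n - r) / partition_function \<alpha> \<beta> n"

text \<open>Pairs the factors of the falling factorial of n - r with those of the partition function
  ratio, so that each quotient can be bounded by 1 and tends to 1. For \<open>2 * r \<le> n\<close>
  all numerators are positive.\<close>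

lemma binomial_moment_eq_prod:
  assumes "\<alpha> > 0" "\<beta> > 0" "2 * r \<le> n"
  shows "binomial_moment \<alpha> \<beta> n r =
    (\<Prod>i<r. (real n - real r - real i) / ((\<alpha> + \<beta>) / (\<alpha> * \<beta>) + (real n - 1 - real i))) / fact r"
proof -
  have "real ((n - r) choose r) = (\<Prod>i<r. real n - real r - real i) / fact r"
    using assms(3) by (simp add: binomial_gbinomial gbinomial_prod_rev of_nat_diff atLeast0LessThan)
  moreover have "(\<alpha> * \<beta>) ^ r * partition_function \<alpha> \<beta> (n - r) / partition_function \<alpha> \<beta> n =
      (\<Prod>i<r. 1 / ((\<alpha> + \<beta>) / (\<alpha> * \<beta>) + (real n - 1 - real i)))"
    using assms by (subst partition_function_ratio) (auto intro!: prod.cong simp: of_nat_diff)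
  ultimately have "binomial_moment \<alpha> \<beta> n r = (\<Prod>i<r. real n - real r - real i) / fact r *
      (\<Prod>i<r. 1 / ((\<alpha> + \<beta>) / (\<alpha> * \<beta>) + (real n - 1 - real i)))"
    by (simp only: binomial_moment_def mult.assoc flip: times_divide_eq_right)
  then show ?thesis
    by (simp add: prod_dividef)
qed

text \<open>If \<open>2 * r \<le> n\<close>, each quotient has numerator at most n - 1 - i, because
  i < r forces r to be at least 1, and a larger denominator. Otherwise n - r < r and the binomial
  coefficient vanishes.\<close>

lemma binomial_moment_bounds:
  assumes "\<alpha> > 0" "\<beta> > 0" "r \<le> n"
  shows "0 \<le> binomial_moment \<alpha> \<beta> n r"
    and "binomial_moment \<alpha> \<beta> n r \<le> 1 / fact r"
proof -
  have Z: "partition_function \<alpha> \<beta> k > 0" for k by (rule partition_function_pos[OF assms(1,2)])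
  show "0 \<le> binomial_moment \<alpha> \<beta> n r" using assms Z[of n] Z[of "n - r"] by (simp add: binomial_moment_def)
  show "binomial_moment \<alpha> \<beta> n r \<le> 1 / fact r"
  proof (cases "2 * r \<le> n")
    case True
    have c: "(\<alpha> + \<beta>) / (\<alpha> * \<beta>) > 0" using assms by simp
    have "(\<Prod>i<r. (real n - real r - real i) / ((\<alpha> + \<beta>) / (\<alpha> * \<beta>) + (real n - 1 - real i))) \<le> 1"
    proof (rule prod_le_1)
      fix i assume "i \<in> {..<r}"
      then have i: "real i + 1 \<le> real r" "2 * real r \<le> real n" using True by auto
      define c where "c = (\<alpha> + \<beta>) / (\<alpha> * \<beta>)"
      have "c > 0" using c by (simp add: c_def)
      have "0 \<le> (real n - real r - real i) / (c + (real n - 1 - real i))"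
        using i \<open>c > 0\<close> by (intro divide_nonneg_nonneg) linarith+
      moreover have "(real n - real r - real i) / (c + (real n - 1 - real i)) \<le> 1"
        using i \<open>c > 0\<close> by (subst divide_le_eq_1_pos) linarith+
      ultimately show "0 \<le> (real n - real r - real i) / ((\<alpha> + \<beta>) / (\<alpha> * \<beta>) + (real n - 1 - real i)) \<and>
          (real n - real r - real i) / ((\<alpha> + \<beta>) / (\<alpha> * \<beta>) + (real n - 1 - real i)) \<le> 1"
        by (simp add: c_def)
    qed
    then show ?thesis
      unfolding binomial_moment_eq_prod[OF assms(1,2) True]
      by (intro divide_right_mono) auto
  next
    case False
    then have "(n - r) choose r = 0" by (intro binomial_eq_0) auto
    then show ?thesis unfolding binomial_moment_def by (simp only:) simp
  qed
qed

lemma tendsto_binomial_moment: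
  assumes "\<alpha> > 0" "\<beta> > 0"
  shows "(\<lambda>n. binomial_moment \<alpha> \<beta> n r) \<longlonglongrightarrow> 1 / fact r"
proof -
  have "(\<lambda>n. (real n - real r - real i) / (c + (real n - 1 - real i))) \<longlonglongrightarrow> 1" for i and c :: real
    by real_asymp
  then have "(\<lambda>n. (\<Prod>i<r. (real n - real r - real i) / ((\<alpha> + \<beta>) / (\<alpha> * \<beta>) + (real n - 1 - real i))) / fact r)
      \<longlonglongrightarrow> (\<Prod>i<r. 1) / fact r"
    by (intro tendsto_intros) auto
  moreover have "eventually (\<lambda>n. (\<Prod>i<r. (real n - real r - real i) / ((\<alpha> + \<beta>) / (\<alpha> * \<beta>) + (real n - 1 - real i))) / fact r =
      binomial_moment \<alpha> \<beta> n r) sequentially"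
    using eventually_ge_at_top[of "2 * r"]
    by eventually_elim (simp only: binomial_moment_eq_prod[OF assms])
  ultimately show ?thesis
    by (simp add: tendsto_cong)
qed

section \<open>Convergence to the Poisson law\<close>

theorem theorem5p2:
  fixes \<alpha> \<beta> :: real
  assumes "\<alpha> > 0" and "\<beta> > 0"
  shows "weak_conv_m
    (\<lambda>n. distr (measure_pmf (random_tableau n \<alpha> \<beta>)) borel (\<lambda>T. real (second_diagonal_symbols n T)))
    (distr (measure_pmf (poisson_pmf 1)) borel real)"
proof (rule levy_continuity)
  fix t
  define z where "z = iexp t - 1"
  \<comment> \<open>Extension by 0 beyond \<open>n\<close> turns the finite sums into series over
    all \<open>r\<close>, so that the limit can be taken termwise.\<close>
  define a where "a = (\<lambda>r n. if r \<le> n then complex_of_real (binomial_moment \<alpha> \<beta> n r) * z ^ r else 0)"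
  have char: "char (distr (measure_pmf (random_tableau n \<alpha> \<beta>)) borel
      (\<lambda>T. real (second_diagonal_symbols n T))) t = (\<Sum>r. a r n)" if "n > 0" for n
  proof -
    have "(\<Sum>r. a r n) = (\<Sum>r\<le>n. a r n)"
      by (rule suminf_finite) (auto simp: a_def)
    also have "\<dots> = (\<Sum>r\<le>n. of_nat ((n - r) choose r) * (z * of_real (\<alpha> * \<beta>)) ^ r *
        of_real (partition_function \<alpha> \<beta> (n - r))) / of_real (partition_function \<alpha> \<beta> n)"
      unfolding sum_divide_distrib
      by (rule sum.cong) (auto simp: a_def binomial_moment_def power_mult_distrib mult_ac)
    finally show ?thesis using char_random_tableau[OF assms that, of t] by (simp add: z_def)
  qed
  have "(\<lambda>n. \<Sum>r. a r n) \<longlonglongrightarrow> (\<Sum>r. complex_of_real (1 / fact r) * z ^ r)"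
  \<comment> \<open>Dominated convergence for series: termwise limits together with a summable
    majorant independent of \<open>n\<close>.\<close>
  proof (intro tannerys_theorem[THEN conjunct2, THEN conjunct2])
    fix r
    have "eventually (\<lambda>n. a r n = complex_of_real (binomial_moment \<alpha> \<beta> n r) * z ^ r) sequentially"
      using eventually_ge_at_top[of r] by eventually_elim (simp add: a_def)
    moreover have "(\<lambda>n. complex_of_real (binomial_moment \<alpha> \<beta> n r) * z ^ r)
        \<longlonglongrightarrow> complex_of_real (1 / fact r) * z ^ r"
      by (intro tendsto_mult tendsto_of_real tendsto_const
          tendsto_binomial_moment assms)
    ultimately show "(\<lambda>n. a r n) \<longlonglongrightarrow> complex_of_real (1 / fact r) * z ^ r"
      by (subst tendsto_cong)
  next
    \<comment> \<open>The bound 1 / r! on the binomial moments makes the exponential series at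
      \<open>norm z\<close> a majorant.\<close>
    have "norm (a r n) \<le> norm z ^ r /\<^sub>R fact r" for r n
    proof (cases "r \<le> n")
      case True
      note b = binomial_moment_bounds[OF assms True]
      have "norm (a r n) = (binomial_moment \<alpha> \<beta> n r) * norm z ^ r"
        using True b(1) by (simp only: a_def if_True norm_mult norm_of_real norm_power abs_of_nonneg)
      also have "\<dots> \<le> 1 / fact r * norm z ^ r"
        by (intro mult_right_mono b(2)) auto
      finally show ?thesis by (simp add: divide_inverse)
    qed (simp add: a_def)
    then show "eventually (\<lambda>(r, n). norm (a r n) \<le> norm z ^ r /\<^sub>R fact r) (at_top \<times>\<^sub>F sequentially)"
      by (intro always_eventually) auto
    show "summable (\<lambda>r. norm z ^ r /\<^sub>R fact r)"
      by (rule sums_summable[OF exp_converges])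
  qed auto
  also have "(\<Sum>r. complex_of_real (1 / fact r) * z ^ r) = exp z"
    unfolding exp_def by (simp add: scaleR_conv_of_real divide_inverse)
  finally have lim: "(\<lambda>n. \<Sum>r. a r n) \<longlonglongrightarrow> exp z" .
  \<comment> \<open>The series formula was shown for positive \<open>n\<close> only, which suffices
    for the limit.\<close>
  have ev: "eventually (\<lambda>n. char (distr (measure_pmf (random_tableau n \<alpha> \<beta>)) borel
      (\<lambda>T. real (second_diagonal_symbols n T))) t = (\<Sum>r. a r n)) sequentially"
    using eventually_gt_at_top[of 0] by eventually_elim (rule char)
  show "(\<lambda>n. char (distr (measure_pmf (random_tableau n \<alpha> \<beta>)) borel
      (\<lambda>T. real (second_diagonal_symbols n T))) t)
      \<longlonglongrightarrow> char (distr (measure_pmf (poisson_pmf 1)) borel real) t"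
    unfolding char_poisson tendsto_cong[OF ev] using lim by (simp add: z_def)
qed (auto intro!: prob_space.real_distribution_distr prob_space_measure_pmf)

end
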